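(* Let $k^t,k^d\in\mathbb{N}$ and $\alpha\in\mathbb{N}$. For every deterministic online policy $\mathrm{ALG}$ for the relief distribution problem there is an instance $I$ with $k^t$ trucks, $k^d$ drones and drone speed $\alpha$ such that $$\frac{\mathrm{ALG}(I)}{\mathrm{OPT}(I^* )}\ \ge\ 2-\frac{1}{2\alpha}.$$
   Context: Relief distribution problem (RDP). $\mathbb{N}=\{1,2,\dots\}$. An instance is $I=(k^t,k^d,\alpha,G,D)$: $k^t,k^d\in\mathbb{N}$ are the numbers of trucks and drones; $\alpha>0$ is the drone speed; $G=(V,E,c)$ is a finite connected undirected graph (not necessarily complete) with $V=\{v_0\}\cup C$, where $v_0$ is the depot and $C\neq\emptyset$ is the set of non-depot nodes; edge lengths $c(i,j)>0$ satisfy the triangle inequality; $D\subseteq C$ is the set of damaged nodes. For non-adjacent $i,j$, $c(i,j)$ is the shortest-path distance. A truck needs time $c(i,j)$ to traverse an edge, a drone needs $\frac1\alpha c(i,j)$. A tour is a closed walk in $G$ starting and ending at $v_0$ (possibly of length $0$); it visits all nodes lying on it. The makespan of a family of tours is the maximum duration of a tour. A feasible solution consists of $k^t$ truck tours and $k^d$ drone tours such that every node of $C$ is visited by some vehicle and every node of $D$ is visited by a truck. $\mathrm{OPT}(I^* )$ is the minimum makespan of a feasible solution ($I^*$ is the instance $I$ with $D$ known in advance). Online setting: initially everything except $D$ is known; whether $v\in C$ is damaged is revealed (to all vehicles, instantly) when some vehicle first arrives at $v$. A deterministic online policy $\mathrm{ALG}$ prescribes at every time, based only on the initially known data and the damage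 statuses revealed so far, how each vehicle acts (move along edges or wait), all vehicles starting at $v_0$ at time $0$, such that for every $D$ the executed tours form a feasible solution. $\mathrm{ALG}(I)$ is the time at which the last vehicle has returned to $v_0$. *)

theory Defs
  imports "HOL-Analysis.Analysis"
begin

section \<open>Instances\<close>

text \<open>Everything that is known before the vehicles start; an instance is a pair of such data and
  a set of damaged nodes. Undirected edges are two-element sets, so edge lengths are symmetric.\<close>

record 'v rdp_data =
  n_trucks :: nat
  n_drones :: nat
  drone_speed :: real
  depot :: 'v
  nodes :: "'v set"
  edges :: "'v set set"
  edge_len :: "'v set \<Rightarrow> real"

definition customers :: "'v rdp_data \<Rightarrow> 'v set" where
  "customers K = nodes K - {depot K}"

definition walk :: "'v rdp_data \<Rightarrow> 'v list \<Rightarrow> bool" where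
  "walk K p \<longleftrightarrow> p \<noteq> [] \<and> set p \<subseteq> nodes K \<and> successively (\<lambda>u w. {u, w} \<in> edges K) p"

definition walk_len :: "'v rdp_data \<Rightarrow> 'v list \<Rightarrow> real" where
  "walk_len K p = (\<Sum>(u, w) \<leftarrow> zip p (tl p). edge_len K {u, w})"

definition path_dist :: "'v rdp_data \<Rightarrow> 'v \<Rightarrow> 'v \<Rightarrow> real" where
  "path_dist K i j = Inf {walk_len K p |p. walk K p \<and> hd p = i \<and> last p = j}"

definition cost :: "'v rdp_data \<Rightarrow> 'v \<Rightarrow> 'v \<Rightarrow> real" where
  "cost K i j = (if {i, j} \<in> edges K then edge_len K {i, j} else path_dist K i j)"

definition rdp_data_ok :: "'v rdp_data \<Rightarrow> bool" where
  "rdp_data_ok K \<longleftrightarrow>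
     n_trucks K \<ge> 1 \<and> n_drones K \<ge> 1 \<and> drone_speed K > 0 \<and>
     finite (nodes K) \<and> depot K \<in> nodes K \<and> customers K \<noteq> {} \<and>
     edges K \<subseteq> {{u, w} |u w. u \<in> nodes K \<and> w \<in> nodes K \<and> u \<noteq> w} \<and>
     (\<forall>u\<in>nodes K. \<forall>w\<in>nodes K. \<exists>p. walk K p \<and> hd p = u \<and> last p = w) \<and>
     (\<forall>e\<in>edges K. edge_len K e > 0) \<and>
     (\<forall>i\<in>nodes K. \<forall>j\<in>nodes K. \<forall>k\<in>nodes K. cost K i k \<le> cost K i j + cost K j k)"

definition rdp_instance :: "'v rdp_data \<Rightarrow> 'v set \<Rightarrow> bool" where
  "rdp_instance K D \<longleftrightarrow> rdp_data_ok K \<and> D \<subseteq> customers K"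

datatype vehicle = Truck nat | Drone nat

definition vehicles :: "'v rdp_data \<Rightarrow> vehicle set" where
  "vehicles K = Truck ` {..<n_trucks K} \<union> Drone ` {..<n_drones K}"

fun speed :: "'v rdp_data \<Rightarrow> vehicle \<Rightarrow> real" where
  "speed K (Truck i) = 1"
| "speed K (Drone i) = drone_speed K"


section \<open>Offline solutions\<close>

definition tour :: "'v rdp_data \<Rightarrow> 'v list \<Rightarrow> bool" where
  "tour K p \<longleftrightarrow> walk K p \<and> hd p = depot K \<and> last p = depot K"

definition feasible :: "'v rdp_data \<Rightarrow> 'v set \<Rightarrow> (vehicle \<Rightarrow> 'v list) \<Rightarrow> bool" where
  "feasible K D S \<longleftrightarrow>
     (\<forall>f\<in>vehicles K. tour K (S f)) \<and>
     (\<forall>v\<in>customers K. \<exists>f\<in>vehicles K. v \<in> set (S f)) \<and>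
     (\<forall>v\<in>D. \<exists>i<n_trucks K. v \<in> set (S (Truck i)))"

definition makespan :: "'v rdp_data \<Rightarrow> (vehicle \<Rightarrow> 'v list) \<Rightarrow> real" where
  "makespan K S = Max ((\<lambda>f. walk_len K (S f) / speed K f) ` vehicles K)"

text \<open>The infimum is a minimum: edge lengths are positive and the graph is finite, so only
  finitely many makespans lie below any given bound.\<close>

definition OPT :: "'v rdp_data \<Rightarrow> 'v set \<Rightarrow> real" where
  "OPT K D = Inf {makespan K S |S. feasible K D S}"


section \<open>Online policies\<close>

text \<open>Positions are points of the geometric realization of the graph, in barycentric coordinates:
  \<open>edge_pos u w l\<close> is the point dividing the edge from \<open>u\<close> to \<open>w\<close> in the ratio \<open>l : 1 - l\<close>.\<close>

definition node_pos :: "'v \<Rightarrow> 'v \<Rightarrow> real" where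
  "node_pos v = (\<lambda>x. of_bool (x = v))"

definition edge_pos :: "'v \<Rightarrow> 'v \<Rightarrow> real \<Rightarrow> 'v \<Rightarrow> real" where
  "edge_pos u w l = (\<lambda>x. (1 - l) * node_pos u x + l * node_pos w x)"

text \<open>\<open>Go w\<close>: move along an edge towards its endpoint \<open>w\<close>, either from the other endpoint or from
  an interior point of the edge. Hence waiting and turning around inside an edge are possible.\<close>

datatype 'v action = Wait | Go 'v

text \<open>A policy sees the initial data, the current time and the statuses revealed so far
  (\<open>Some True\<close>: damaged, \<open>Some False\<close>: undamaged). The times of the revelations and the past
  movements need not be arguments: for a deterministic policy they are determined by these
  (by replaying the policy from time 0).\<close>

type_synonym 'v policy = "'v rdp_data \<Rightarrow> real \<Rightarrow> ('v \<Rightarrow> bool option) \<Rightarrow> vehicle \<Rightarrow> 'v action"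

type_synonym 'v motion = "vehicle \<Rightarrow> real \<Rightarrow> 'v \<Rightarrow> real"

definition revealed :: "'v rdp_data \<Rightarrow> 'v set \<Rightarrow> 'v motion \<Rightarrow> real \<Rightarrow> 'v \<Rightarrow> bool option" where
  "revealed K D X t = (\<lambda>v.
     if v \<in> customers K \<and> (\<exists>f\<in>vehicles K. \<exists>r\<in>{0..t}. X f r = node_pos v)
     then Some (v \<in> D) else None)"

text \<open>The movement \<open>x\<close> of a vehicle of speed \<open>s\<close> performs the given action from time \<open>t\<close> on,
  for some positive amount of time.\<close>

fun performs :: "'v rdp_data \<Rightarrow> real \<Rightarrow> (real \<Rightarrow> 'v \<Rightarrow> real) \<Rightarrow> real \<Rightarrow> 'v action \<Rightarrow> bool" where
  "performs K s x t Wait \<longleftrightarrow> (\<exists>\<epsilon>>0. \<forall>h\<in>{0..\<epsilon>}. x (t + h) = x t)"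
| "performs K s x t (Go w) \<longleftrightarrow>
     (\<exists>u l. {u, w} \<in> edges K \<and> 0 \<le> l \<and> l < 1 \<and>
        (\<exists>\<epsilon>>0. \<forall>h\<in>{0..\<epsilon>}. x (t + h) = edge_pos u w (l + s * h / edge_len K {u, w})))"

definition execution :: "'v policy \<Rightarrow> 'v rdp_data \<Rightarrow> 'v set \<Rightarrow> 'v motion \<Rightarrow> bool" where
  "execution A K D X \<longleftrightarrow>
     (\<forall>f\<in>vehicles K.
        X f 0 = node_pos (depot K) \<and> continuous_on {0..} (X f) \<and>
        (\<forall>t\<ge>0. performs K (speed K f) (X f) t (A K t (revealed K D X t) f)))"

definition home_from :: "'v rdp_data \<Rightarrow> 'v motion \<Rightarrow> real \<Rightarrow> bool" where
  "home_from K X T \<longleftrightarrow> (\<forall>f\<in>vehicles K. \<forall>t\<ge>T. X f t = node_pos (depot K))"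

definition executed_feasible :: "'v rdp_data \<Rightarrow> 'v set \<Rightarrow> 'v motion \<Rightarrow> bool" where
  "executed_feasible K D X \<longleftrightarrow>
     (\<exists>T\<ge>0. home_from K X T) \<and>
     (\<forall>v\<in>customers K. \<exists>f\<in>vehicles K. \<exists>t\<ge>0. X f t = node_pos v) \<and>
     (\<forall>v\<in>D. \<exists>i<n_trucks K. \<exists>t\<ge>0. X (Truck i) t = node_pos v)"

definition online_policy :: "'v policy \<Rightarrow> bool" where
  "online_policy A \<longleftrightarrow>
     (\<forall>K D. rdp_instance K D \<longrightarrow> (\<exists>X. execution A K D X \<and> executed_feasible K D X))"

lemma edge_pos_eqD:
  assumes eq: "edge_pos u w l = edge_pos u' w l'"
    and "u \<noteq> w" "u' \<noteq> w" "l < 1" "l' < 1"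
  shows "u = u' \<and> l = l'"
proof -
  have l: "l = l'"
    using fun_cong[OF eq, of w] assms by (simp add: edge_pos_def node_pos_def)
  moreover have "u = u'"
    using fun_cong[OF eq, of u] assms by (auto simp: edge_pos_def node_pos_def of_bool_def split: if_splits)
  ultimately show ?thesis by simp
qed

lemma performs_unique:
  assumes "rdp_data_ok K" "performs K s x t a" "performs K s y t a" "x t = y t"
  shows "\<exists>\<epsilon>>0. \<forall>h\<in>{0..\<epsilon>}. x (t + h) = y (t + h)"
proof (cases a)
  case Wait
  with assms(2,3) obtain e1 e2 where "e1 > 0" "\<forall>h\<in>{0..e1}. x (t + h) = x t"
    "e2 > 0" "\<forall>h\<in>{0..e2}. y (t + h) = y t" by auto
  with assms(4) show ?thesis by (intro exI[of _ "min e1 e2"]) auto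
next
  case (Go w)
  from assms(2) Go obtain u l e1 where
    1: "{u, w} \<in> edges K" "0 \<le> l" "l < 1" "e1 > 0"
      "\<forall>h\<in>{0..e1}. x (t + h) = edge_pos u w (l + s * h / edge_len K {u, w})" by auto
  from assms(3) Go obtain u' l' e2 where
    2: "{u', w} \<in> edges K" "0 \<le> l'" "l' < 1" "e2 > 0"
      "\<forall>h\<in>{0..e2}. y (t + h) = edge_pos u' w (l' + s * h / edge_len K {u', w})" by auto
  have ne: "u \<noteq> w" "u' \<noteq> w"
    using assms(1) 1(1) 2(1) by (auto simp: rdp_data_ok_def doubleton_eq_iff)
  have "edge_pos u w l = edge_pos u' w l'"
    using bspec[OF 1(5), of 0] bspec[OF 2(5), of 0] 1(4) 2(4) assms(4) by simp
  then have "u = u' \<and> l = l'" using ne 1(3) 2(3) by (rule edge_pos_eqD)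
  with 1 2 show ?thesis by (intro exI[of _ "min e1 e2"]) auto
qed

lemma finite_vehicles [simp]: "finite (vehicles K)"
  by (simp add: vehicles_def)

text \<open>A policy has at most one execution on each instance, so the choice below is immaterial.\<close>

lemma execution_unique:
  assumes ok: "rdp_data_ok K" and X: "execution A K D X" and Y: "execution A K D Y"
    and f: "f \<in> vehicles K" and t: "t \<ge> 0"
  shows "X f t = Y f t"
proof (rule ccontr)
  assume neq: "X f t \<noteq> Y f t"
  define B where "B = {r. r \<ge> 0 \<and> (\<exists>g\<in>vehicles K. X g r \<noteq> Y g r)}"
  define T where "T = Inf B"
  have B: "t \<in> B" "bdd_below B" using neq f t by (auto simp: B_def intro!: bdd_belowI[of _ 0])
  have T0: "T \<ge> 0" unfolding T_def using B by (intro cInf_greatest) (auto simp: B_def)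
  have before: "X g r = Y g r" if "g \<in> vehicles K" "0 \<le> r" "r < T" for g r
  proof (rule ccontr)
    assume "X g r \<noteq> Y g r"
    with that have "r \<in> B" by (auto simp: B_def)
    then have "T \<le> r" unfolding T_def using B by (intro cInf_lower)
    with that show False by simp
  qed
  have atT: "X g T = Y g T" if g: "g \<in> vehicles K" for g
  proof (cases "T = 0")
    case True
    then show ?thesis using X Y g by (simp add: execution_def)
  next
    case False
    then have T: "T > 0" using T0 by simp
    have cont: "continuous_on {0..T} (X g)" "continuous_on {0..T} (Y g)"
      using X Y g by (auto simp: execution_def intro: continuous_on_subset)
    show ?thesis
    proof (rule ext)
      fix v
      have c: "continuous_on {0..T} (\<lambda>r. X g r v)" "continuous_on {0..T} (\<lambda>r. Y g r v)"
        using cont by (auto intro: continuous_on_product_then_coordinatewise)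
      have "closed {r \<in> {0..T}. X g r v = Y g r v}"
        using continuous_closed_preimage_constant
          [of "{0..T}" "\<lambda>r. X g r v - Y g r v" 0] continuous_on_diff[OF c] by simp
      moreover have "{0..<T} \<subseteq> {r \<in> {0..T}. X g r v = Y g r v}"
        using before g by auto
      ultimately have "closure {0..<T} \<subseteq> {r \<in> {0..T}. X g r v = Y g r v}"
        by (rule closure_minimal[rotated])
      then show "X g T v = Y g T v" using T by (simp add: subset_iff)
    qed
  qed
  have upto: "X g r = Y g r" if "g \<in> vehicles K" "0 \<le> r" "r \<le> T" for g r
    using that before atT by (cases "r = T") auto
  have rev: "revealed K D X T = revealed K D Y T"
    unfolding revealed_def using upto by (intro ext if_cong) auto
  have "\<exists>\<epsilon>>0. \<forall>h\<in>{0..\<epsilon>}. X g (T + h) = Y g (T + h)" if g: "g \<in> vehicles K" for g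
    using X Y g T0 rev atT[OF g] unfolding execution_def
    by (intro performs_unique[OF ok]) auto
  then obtain e where e: "e g > 0" "\<forall>h\<in>{0..e g}. X g (T + h) = Y g (T + h)"
    if "g \<in> vehicles K" for g by metis
  define m where "m = Min (e ` vehicles K)"
  have "m \<in> e ` vehicles K" unfolding m_def using f by (intro Min_in) auto
  then have m: "m > 0" "\<And>g. g \<in> vehicles K \<Longrightarrow> m \<le> e g"
    using e(1) by (auto simp: m_def)
  have "T + m \<le> r" if r: "r \<in> B" for r
  proof (rule ccontr)
    assume less: "\<not> T + m \<le> r"
    from r obtain g where g: "g \<in> vehicles K" "X g r \<noteq> Y g r" by (auto simp: B_def)
    have "T \<le> r" unfolding T_def using r B by (intro cInf_lower)
    then have "X g (T + (r - T)) = Y g (T + (r - T))"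
      using less m(2)[OF g(1)] by (intro bspec[OF e(2)[OF g(1)]]) auto
    with g show False by simp
  qed
  then have "T + m \<le> T" unfolding T_def using B by (intro cInf_greatest) auto
  with m show False by simp
qed

definition completion_time :: "'v rdp_data \<Rightarrow> 'v motion \<Rightarrow> real" where
  "completion_time K X = Inf {T. T \<ge> 0 \<and> home_from K X T}"

definition policy_time :: "'v policy \<Rightarrow> 'v rdp_data \<Rightarrow> 'v set \<Rightarrow> real" where
  "policy_time A K D = completion_time K (SOME X. execution A K D X)"

end

theory Submission imports Defs begin

text \<open>Take a star with unit edges and \<open>k\<^sup>t + \<alpha> k\<^sup>d\<close> leaves, so that \<open>OPT \<le> 2\<close> whenever a
  single leaf is damaged: each truck serves one leaf and each drone \<open>\<alpha>\<close> leaves. Run the policy without any damage up to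
  time \<open>T = 2 - 1/\<alpha>\<close>. Before \<open>T\<close> each drone has reached at most \<open>\<alpha> - 1\<close> leaves, and each truck has
  touched only leaves on whose edge it still is, hence at most one. So some leaf has not been
  reached before \<open>T\<close> and has no truck on its edge at time \<open>T\<close>. If exactly this leaf is damaged,
  the policy behaves in the same way up to \<open>T\<close>, and a truck needs two more time units.\<close>

section \<open>Real induction and one-sided growth bounds\<close>

text \<open>The infimum of the failures in \<open>{a..b}\<close> satisfies \<open>P\<close> by
  \<open>base\<close> or \<open>limit\<close>, and \<open>step\<close> carries \<open>P\<close> past
  it, a contradiction. An action fixes a motion only for an unspecified positive time, so this
  serves as induction over time; \<open>step\<close> gets the whole past because revelations depend
  on it.\<close>

lemma real_induction [consumes 1, case_names base step limit]:
  fixes a b :: real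
  assumes "t \<in> {a..b}"
    and base: "P a"
    and step: "\<And>t. a \<le> t \<Longrightarrow> t < b \<Longrightarrow> \<forall>r\<in>{a..t}. P r \<Longrightarrow> \<exists>\<epsilon>>0. \<forall>h\<in>{0..\<epsilon>}. P (t + h)"
    and limit: "\<And>t. a < t \<Longrightarrow> t \<le> b \<Longrightarrow> \<forall>r\<in>{a..<t}. P r \<Longrightarrow> P t"
  shows "P t"
proof (rule ccontr)
  assume "\<not> P t"
  define B where "B = {r \<in> {a..b}. \<not> P r}"
  define m where "m = Inf B"
  have B: "t \<in> B" "bdd_below B"
    using assms(1) \<open>\<not> P t\<close> by (auto simp: B_def intro!: bdd_belowI[of _ a])
  have "a \<le> m" unfolding m_def using B by (intro cInf_greatest) (auto simp: B_def)
  have "m \<le> t" unfolding m_def using B by (intro cInf_lower)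
  then have "m \<le> b" using assms(1) by simp
  have below: "P r" if "r \<in> {a..<m}" for r
  proof (rule ccontr)
    assume "\<not> P r"
    then have "r \<in> B" using that \<open>m \<le> b\<close> by (auto simp: B_def)
    then have "m \<le> r" unfolding m_def using B by (intro cInf_lower)
    then show False using that by simp
  qed
  have "P m"
    using base limit[of m] below \<open>a \<le> m\<close> \<open>m \<le> b\<close> by (cases "m = a") auto
  then have upto: "\<forall>r\<in>{a..m}. P r"
    using below by (metis atLeastAtMost_iff atLeastLessThan_iff order_le_less)
  have "m < b"
    using \<open>P m\<close> \<open>\<not> P t\<close> \<open>m \<le> t\<close> assms(1) by (cases "m = t") auto
  from step[OF \<open>a \<le> m\<close> this upto] obtain e where e: "e > 0" "\<And>h. h \<in> {0..e} \<Longrightarrow> P (m + h)"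
    by blast
  have "m + e \<le> r" if "r \<in> B" for r
  proof (rule ccontr)
    assume "\<not> m + e \<le> r"
    moreover have "m \<le> r" unfolding m_def using that B by (intro cInf_lower)
    ultimately have "P r" using e(2)[of "r - m"] by simp
    then show False using that by (simp add: B_def)
  qed
  then have "m + e \<le> m" unfolding m_def using B by (intro cInf_greatest) auto
  then show False using e(1) by simp
qed

text \<open>A mean value inequality for the one-sided local bounds that \<open>performs\<close>
  supplies; continuity carries the bound to limit times.\<close>

lemma increment_le:
  fixes \<phi> :: "real \<Rightarrow> real"
  assumes "a \<le> b" and cont: "continuous_on {a..b} \<phi>"
    and loc: "\<And>t. a \<le> t \<Longrightarrow> t < b \<Longrightarrow> \<exists>\<epsilon>>0. \<forall>h\<in>{0..\<epsilon>}. \<phi> (t + h) \<le> \<phi> t + c * h"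
  shows "\<phi> b \<le> \<phi> a + c * (b - a)"
proof -
  have "b \<in> {a..b}" using assms(1) by simp
  then show ?thesis
  proof (induction rule: real_induction)
    case base
    show ?case by simp
  next
    case (step t)
    from loc[OF step(1,2)] obtain e where e: "e > 0" "\<forall>h\<in>{0..e}. \<phi> (t + h) \<le> \<phi> t + c * h" by blast
    have "\<phi> t \<le> \<phi> a + c * (t - a)" using step by simp
    then have "\<phi> (t + h) \<le> \<phi> a + c * (t + h - a)" if "h \<in> {0..e}" for h
      using e(2) that by (fastforce simp: algebra_simps)
    with e(1) show ?case by blast
  next
    case (limit t)
    \<comment> \<open>With all terms in \<open>r\<close> on one side, the bound becomes the preimage
      of a closed half-line, so it passes from \<open>{a..<t}\<close> to its closure.\<close>
    have "closed {r \<in> {a..t}. \<phi> r - c * r \<in> {.. \<phi> a - c * a}}"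
      using limit by (intro continuous_closed_preimage[of "{a..t}", simplified vimage_def Int_def mem_Collect_eq]
          continuous_intros continuous_on_subset[OF cont]) auto
    moreover have "{a..<t} \<subseteq> {r \<in> {a..t}. \<phi> r - c * r \<in> {.. \<phi> a - c * a}}"
      using limit by (auto simp: algebra_simps)
    ultimately have "closure {a..<t} \<subseteq> {r \<in> {a..t}. \<phi> r - c * r \<in> {.. \<phi> a - c * a}}"
      by (rule closure_minimal[rotated])
    then have "t \<in> {r \<in> {a..t}. \<phi> r - c * r \<in> {.. \<phi> a - c * a}}"
      using limit by (simp add: subset_iff)
    then show ?case by (simp add: algebra_simps)
  qed
qed

section \<open>The star instance\<close>

text \<open>Node 0 is the centre, the leaves are \<open>1..n\<close>. The length is 1 on every set,
  edge or not, so that \<open>star_walk_len\<close> holds for arbitrary lists.\<close>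

definition star :: "nat \<Rightarrow> nat \<Rightarrow> real \<Rightarrow> nat \<Rightarrow> nat rdp_data" where
  "star kt kd a n = \<lparr>n_trucks = kt, n_drones = kd, drone_speed = a, depot = 0, nodes = {0..n},
     edges = (\<lambda>i. {0, i}) ` {1..n}, edge_len = (\<lambda>_. 1)\<rparr>"

lemma star_simps [simp]:
  "n_trucks (star kt kd a n) = kt" "n_drones (star kt kd a n) = kd"
  "drone_speed (star kt kd a n) = a" "depot (star kt kd a n) = 0"
  "nodes (star kt kd a n) = {0..n}" "edge_len (star kt kd a n) e = 1"
  by (simp_all add: star_def)

lemma star_edges: "{u, w} \<in> edges (star kt kd a n) \<longleftrightarrow> (u = 0 \<and> w \<in> {1..n} \<or> w = 0 \<and> u \<in> {1..n})"
proof -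
  have "{u, w} \<in> edges (star kt kd a n) \<longleftrightarrow> (\<exists>i\<in>{1..n}. {u, w} = {0, i})"
    by (simp add: star_def image_iff)
  then show ?thesis unfolding doubleton_eq_iff by blast
qed

lemma star_customers [simp]: "customers (star kt kd a n) = {1..n}"
  by (auto simp: customers_def)

lemma star_walk_len: "walk_len (star kt kd a n) p = real (length p - 1)"
proof -
  have "walk_len (star kt kd a n) p = (\<Sum>x\<leftarrow>zip p (tl p). 1)"
    unfolding walk_len_def by (intro arg_cong[where f = sum_list] map_cong) auto
  then show ?thesis by (cases p) (auto simp: sum_list_triv)
qed

text \<open>Distinct ends force at least one step, and any two nodes are joined through the depot in
  at most two. These crude bounds, without exact distances, suffice for the triangle
  inequality.\<close>

lemma star_path_dist:
  assumes "i \<le> n" "j \<le> n"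
  shows "path_dist (star kt kd a n) i j \<ge> of_bool (i \<noteq> j)"
    and "path_dist (star kt kd a n) i j \<le> 2"
    and "path_dist (star kt kd a n) i i \<le> 0"
proof -
  let ?K = "star kt kd a n"
  let ?W = "\<lambda>i j. {walk_len ?K p |p. walk ?K p \<and> hd p = i \<and> last p = j}"
  have ge: "w \<ge> of_bool (i \<noteq> j)" if "w \<in> ?W i j" for w i j
  proof -
    from that obtain p where p: "w = walk_len ?K p" "p \<noteq> []" "hd p = i" "last p = j"
      by (auto simp: walk_def)
    show ?thesis
    proof (cases "i = j")
      case True
      then show ?thesis using p by (simp add: star_walk_len)
    next
      case False
      then have "length p \<ge> 2"
        using p(2-4) by (cases p) (auto simp: neq_Nil_conv split: if_splits)
      then show ?thesis using p(1) by (simp add: star_walk_len)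
    qed
  qed
  have bdd: "bdd_below (?W i j)" for i j
    using ge by (auto intro!: bdd_belowI[of _ "of_bool (i \<noteq> j)"])
  have ii: "0 \<in> ?W i i" if "i \<le> n" for i
    using that by (auto intro!: exI[of _ "[i]"] simp: walk_def star_walk_len)
  have le: "path_dist ?K i j \<le> w" if "w \<in> ?W i j" for i j w
    unfolding path_dist_def using that bdd by (rule cInf_lower)
  show "path_dist ?K i i \<le> 0" using le[OF ii] assms(1) .
  have ex: "\<exists>w\<le>2. w \<in> ?W i j"
  proof -
    consider "i = j" | "i \<noteq> j" "i = 0 \<or> j = 0" | "i \<noteq> 0" "j \<noteq> 0" by blast
    then show ?thesis
    proof cases
      case 1
      then show ?thesis using ii assms by (intro exI[of _ 0]) auto
    next
      case 2
      then have "walk_len ?K [i, j] \<in> ?W i j"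
        using assms by (intro CollectI exI[of _ "[i, j]"]) (auto simp: walk_def star_edges)
      then show ?thesis by (intro exI[of _ "walk_len ?K [i, j]"]) (auto simp: star_walk_len)
    next
      case 3
      then have "walk_len ?K [i, 0, j] \<in> ?W i j"
        using assms by (intro CollectI exI[of _ "[i, 0, j]"]) (auto simp: walk_def star_edges)
      then show ?thesis by (intro exI[of _ "walk_len ?K [i, 0, j]"]) (auto simp: star_walk_len)
    qed
  qed
  then show "path_dist ?K i j \<le> 2" using le by force
  show "path_dist ?K i j \<ge> of_bool (i \<noteq> j)"
    unfolding path_dist_def using ex ge by (intro cInf_greatest) blast+
qed

text \<open>For three distinct nodes the right side is at least 1 + 1 and the left at most 2.
  Otherwise the cost 0 of a node to itself enters, which comes from \<open>path_dist\<close> since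
  no edge is a loop.\<close>

lemma star_cost_triangle:
  assumes "i \<le> n" "j \<le> n" "k \<le> n"
  shows "cost (star kt kd a n) i k \<le> cost (star kt kd a n) i j + cost (star kt kd a n) j k"
proof -
  let ?K = "star kt kd a n"
  have adj: "cost ?K u w = 1" if "u = 0 \<or> w = 0" "u \<noteq> w" "u \<le> n" "w \<le> n" for u w
    using that by (auto simp: cost_def star_edges)
  have le: "cost ?K u w \<le> 2" if "u \<le> n" "w \<le> n" for u w
    using star_path_dist(2)[OF that] by (simp add: cost_def)
  have ge1: "cost ?K u w \<ge> 1" if "u \<noteq> w" "u \<le> n" "w \<le> n" for u w
    using star_path_dist(1)[OF that(2,3), of kt kd a] that(1) by (simp add: cost_def)
  have refl: "cost ?K u u = 0" if "u \<le> n" for u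
    using star_path_dist(1,3)[OF that that, of kt kd a] star_edges[of u u kt kd a n] by (simp add: cost_def)
  consider "i = j" | "j = k" | "i = k" "i \<noteq> j" | "i \<noteq> j" "j \<noteq> k" "i \<noteq> k" by blast
  then show ?thesis
  proof cases
    case 3
    then show ?thesis using refl ge1[of i j] ge1[of j k] assms by simp
  next
    case 4
    then show ?thesis using le[of i k] ge1[of i j] ge1[of j k] assms by simp
  qed (use refl assms in auto)
qed

lemma star_ok:
  assumes "kt \<ge> 1" "kd \<ge> 1" "a > 0" "n \<ge> 1"
  shows "rdp_data_ok (star kt kd a n)"
proof -
  let ?K = "star kt kd a n"
  have "\<exists>p. walk ?K p \<and> hd p = u \<and> last p = w" if "u \<le> n" "w \<le> n" for u w
  proof -
    consider "u = w" | "u \<noteq> w" "u = 0 \<or> w = 0" | "u \<noteq> 0" "w \<noteq> 0" by blast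
    then show ?thesis
    proof cases
      case 1
      then show ?thesis using that by (intro exI[of _ "[u]"]) (auto simp: walk_def)
    next
      case 2
      then show ?thesis using that by (intro exI[of _ "[u, w]"]) (auto simp: walk_def star_edges)
    next
      case 3
      then show ?thesis using that by (intro exI[of _ "[u, 0, w]"]) (auto simp: walk_def star_edges)
    qed
  qed
  moreover have "edges ?K \<subseteq> {{u, w} |u w. u \<in> nodes ?K \<and> w \<in> nodes ?K \<and> u \<noteq> w}"
  proof
    fix e assume "e \<in> edges ?K"
    then obtain i where "e = {0, i}" "i \<in> {1..n}" by (auto simp: star_def)
    then show "e \<in> {{u, w} |u w. u \<in> nodes ?K \<and> w \<in> nodes ?K \<and> u \<noteq> w}"
      by (intro CollectI exI[of _ 0] exI[of _ i]) auto
  qed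
  ultimately show ?thesis
    using assms star_cost_triangle by (auto simp: rdp_data_ok_def)
qed

section \<open>The offline optimum on the star\<close>

lemma makespan_ge:
  assumes "f \<in> vehicles K"
  shows "walk_len K (S f) / speed K f \<le> makespan K S"
  unfolding makespan_def using assms by (intro Max_ge) auto

text \<open>A vehicle that visits leaf 1 crosses at least one edge, and \<open>a\<close> is the
  largest speed. The bound is not sharp; it serves to bound the makespans from below and to make
  \<open>OPT\<close> positive, so that the ratio is meaningful.\<close>

lemma star_makespan_ge:
  assumes "feasible (star kt kd a n) D S" "a \<ge> 1" "n \<ge> 1"
  shows "makespan (star kt kd a n) S \<ge> 1 / a"
proof -
  let ?K = "star kt kd a n"
  obtain f where f: "f \<in> vehicles ?K" "1 \<in> set (S f)"
    using assms(1,3) by (fastforce simp: feasible_def)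
  then have "hd (S f) = 0" "S f \<noteq> []"
    using assms(1) by (auto simp: feasible_def tour_def walk_def)
  then have "length (S f) \<ge> 2"
    using f(2) by (cases "S f") (auto simp: Suc_le_eq)
  then have "walk_len ?K (S f) \<ge> 1" by (simp add: star_walk_len)
  moreover have "speed ?K f > 0" "speed ?K f \<le> a" using assms(2) by (cases f; simp)+
  ultimately have "1 / a \<le> walk_len ?K (S f) / speed ?K f"
    using assms(2) by (intro frac_le) auto
  then show ?thesis using makespan_ge[OF f(1), of S] by simp
qed

definition star_walk :: "nat list \<Rightarrow> nat list" where
  "star_walk vs = 0 # concat (map (\<lambda>v. [v, 0]) vs)"

lemma set_star_walk: "set (star_walk vs) = insert 0 (set vs)"
  by (auto simp: star_walk_def)

lemma length_star_walk: "length (star_walk vs) = 1 + 2 * length vs"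
  by (induction vs) (auto simp: star_walk_def)

lemma tour_star_walk:
  assumes "set vs \<subseteq> {1..n}"
  shows "tour (star kt kd a n) (star_walk vs)"
proof -
  have "successively (\<lambda>u w. {u, w} \<in> edges (star kt kd a n)) (star_walk vs)"
    using assms by (induction vs) (auto simp: star_walk_def star_edges)
  moreover have "last (star_walk vs) = 0"
    by (induction vs) (auto simp: star_walk_def)
  ultimately show ?thesis
    using assms by (auto simp: tour_def walk_def set_star_walk) (simp_all add: star_walk_def)
qed

text \<open>A round trip to one leaf takes a truck time 2, and \<open>\<alpha>\<close> round trips
  take a drone \<open>2 * \<alpha> / \<alpha> = 2\<close>; so all vehicles work for exactly 2 and
  together serve all leaves.\<close>

lemma star_feasible:
  fixes \<alpha> :: nat
  assumes "kt \<ge> 1" "\<alpha> \<ge> 1" "L \<in> {1..kt + \<alpha> * kd}"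
  obtains S where "feasible (star kt kd (real \<alpha>) (kt + \<alpha> * kd)) {L} S"
    and "makespan (star kt kd (real \<alpha>) (kt + \<alpha> * kd)) S \<le> 2"
proof
  let ?n = "kt + \<alpha> * kd"
  let ?K = "star kt kd (real \<alpha>) ?n"
  \<comment> \<open>The transposition of 1 and \<open>L\<close> moves the damaged leaf into the tour
    of truck 0. It is its own inverse, so coverage can be checked on the unpermuted leaves.\<close>
  define \<pi> where "\<pi> i = (if i = 1 then L else if i = L then 1 else i)" for i :: nat
  have \<pi>: "\<pi> i \<in> {1..?n}" if "i \<in> {1..?n}" for i
    using that assms by (auto simp: \<pi>_def)
  have \<pi>\<pi>: "\<pi> (\<pi> i) = i" for i by (simp add: \<pi>_def)
  define S where "S f = star_walk (map \<pi> (case f of Truck i \<Rightarrow> [i + 1]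
     | Drone j \<Rightarrow> map (\<lambda>k. kt + \<alpha> * j + k + 1) [0..<\<alpha>]))" for f
  have in_drone: "kt + \<alpha> * j + k + 1 \<in> {1..?n}" if "j < kd" "k < \<alpha>" for j k
  proof -
    have "\<alpha> * j + \<alpha> \<le> \<alpha> * kd" using mult_le_mono2[of "Suc j" kd \<alpha>] that(1) by simp
    then show ?thesis using that(2) by simp
  qed
  have tours: "tour ?K (S f)" if "f \<in> vehicles ?K" for f
    unfolding S_def using that in_drone
    by (intro tour_star_walk) (auto simp: vehicles_def intro!: \<pi>[simplified] split: vehicle.split)
  have cover: "\<exists>f\<in>vehicles ?K. \<pi> i \<in> set (S f)" if "i \<in> {1..?n}" for i
  proof (cases "i \<le> kt")
    case True
    then show ?thesis using that
      by (intro bexI[of _ "Truck (i - 1)"]) (auto simp: S_def set_star_walk vehicles_def)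
  next
    case False
    \<comment> \<open>\<open>m\<close> numbers the leaves left to the drones from 0; quotient and
      remainder by \<open>\<alpha>\<close> give the drone and the place in its block.\<close>
    define m where "m = i - kt - 1"
    have i: "i = kt + \<alpha> * (m div \<alpha>) + m mod \<alpha> + 1" and "m < \<alpha> * kd"
      using False that by (auto simp: m_def)
    then have "m div \<alpha> < kd" by (simp add: less_mult_imp_div_less mult.commute)
    moreover have "m mod \<alpha> < \<alpha>" using assms(2) by simp
    then have "i \<in> (\<lambda>k. kt + \<alpha> * (m div \<alpha>) + k + 1) ` {0..<\<alpha>}"
      by (intro image_eqI[of _ _ "m mod \<alpha>"] i) simp
    then have "\<pi> i \<in> set (S (Drone (m div \<alpha>)))"
      unfolding S_def set_star_walk by (simp only: vehicle.case set_map set_upt) blast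
    ultimately show ?thesis
      by (intro bexI[of _ "Drone (m div \<alpha>)"]) (auto simp: vehicles_def)
  qed
  have "\<exists>f\<in>vehicles ?K. v \<in> set (S f)" if "v \<in> {1..?n}" for v
    using cover[OF \<pi>[OF that]] by (simp add: \<pi>\<pi>)
  moreover have "L \<in> set (S (Truck 0))" by (simp add: S_def set_star_walk \<pi>_def)
  ultimately show "feasible ?K {L} S"
    using tours assms(1) by (auto simp: feasible_def intro!: exI[of _ 0])
  have "walk_len ?K (S f) / speed ?K f = 2" for f
    using assms(2) by (cases f) (simp_all add: star_walk_len S_def length_star_walk)
  then show "makespan ?K S \<le> 2"
    unfolding makespan_def using assms(1) by (intro Max.boundedI) (auto simp: vehicles_def lessThan_empty_iff)
qed

lemma star_OPT:
  fixes \<alpha> :: nat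
  assumes "kt \<ge> 1" "\<alpha> \<ge> 1" "L \<in> {1..kt + \<alpha> * kd}"
  shows "OPT (star kt kd (real \<alpha>) (kt + \<alpha> * kd)) {L} > 0"
    and "OPT (star kt kd (real \<alpha>) (kt + \<alpha> * kd)) {L} \<le> 2"
proof -
  let ?K = "star kt kd (real \<alpha>) (kt + \<alpha> * kd)"
  obtain S where S: "feasible ?K {L} S" "makespan ?K S \<le> 2"
    using assms by (rule star_feasible)
  have ge: "m \<ge> 1 / real \<alpha>" if "m \<in> {makespan ?K S |S. feasible ?K {L} S}" for m
    using that star_makespan_ge[of kt kd "real \<alpha>"] assms by auto
  have "OPT ?K {L} \<ge> 1 / real \<alpha>"
    unfolding OPT_def using S(1) ge by (intro cInf_greatest) blast+
  then show "OPT ?K {L} > 0"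
    using assms(2) by (auto elim!: less_le_trans[rotated])
  have "OPT ?K {L} \<le> makespan ?K S"
    unfolding OPT_def
  proof (rule cInf_lower)
    show "bdd_below {makespan ?K S |S. feasible ?K {L} S}"
      using ge by (rule bdd_belowI)
  qed (use S(1) in blast)
  then show "OPT ?K {L} \<le> 2" using S(2) by simp
qed

section \<open>Motion of one vehicle on the star\<close>

text \<open>Only the leaf coordinates are tracked. In these, the \<open>\<ell>\<^sub>1\<close> metric is the path metric of
  the star.\<close>

lemma performs_star:
  assumes "performs (star kt kd a n) s x t act" "s \<ge> 0"
  shows "\<exists>\<epsilon>>0. \<exists>i c. \<bar>c\<bar> \<le> s \<and>
    (\<forall>h\<in>{0..\<epsilon>}. \<forall>j\<ge>1. x (t + h) j = x t j + (if j = i then c * h else 0)) \<and>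
    (c = 0 \<or> (\<forall>j\<ge>1. j \<noteq> i \<longrightarrow> x t j = 0))"
proof (cases act)
  case Wait
  with assms obtain e where "e > 0" "\<forall>h\<in>{0..e}. x (t + h) = x t" by auto
  then show ?thesis using assms(2) by (intro exI[of _ e] conjI exI[of _ 0]) auto
next
  case (Go w)
  with assms(1) obtain u l e where e: "{u, w} \<in> edges (star kt kd a n)" "e > 0"
    "\<And>h. h \<in> {0..e} \<Longrightarrow> x (t + h) = edge_pos u w (l + s * h)" by auto
  have x: "x t = edge_pos u w l" using e(3)[of 0] e(2) by simp
  show ?thesis
  proof (cases "u = 0")
    case True
    then show ?thesis using e x assms(2)
      by (intro exI[of _ e] conjI exI[of _ w] exI[of _ s])
        (auto simp: edge_pos_def node_pos_def star_edges algebra_simps)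
  next
    \<comment> \<open>Here \<open>w\<close> is the depot, and the leaf coordinate of
      \<open>u\<close> falls from \<open>1 - l\<close> at rate \<open>s\<close>.\<close>
    case False
    then show ?thesis using e x assms(2)
      by (intro exI[of _ e] conjI exI[of _ u] exI[of _ "-s"])
        (auto simp: edge_pos_def node_pos_def star_edges algebra_simps)
  qed
qed

text \<open>Forgets policy and damage: at each time some action is performed. The speed
  \<open>s\<close> is a parameter of its own, so the bounds apply to trucks (\<open>s = 1\<close>)
  and drones alike.\<close>

locale star_motion =
  fixes kt kd n :: nat and a s :: real and x :: "real \<Rightarrow> nat \<Rightarrow> real"
  assumes speed_nonneg: "s \<ge> 0"
    and start: "x 0 = node_pos 0"
    and cont: "continuous_on {0..} x"
    and moves: "t \<ge> 0 \<Longrightarrow> \<exists>act. performs (star kt kd a n) s x t act"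
begin

lemma cont_coord: "0 \<le> r \<Longrightarrow> continuous_on {r..t} (\<lambda>t. x t j)"
  using continuous_on_product_then_coordinatewise[OF cont]
  by (rule continuous_on_subset) auto

text \<open>At each moment at most one leaf coordinate changes, at rate at most \<open>s\<close>;
  \<open>increment_le\<close> integrates this.\<close>

lemma l1_lipschitz:
  assumes "0 \<le> r" "r \<le> t"
  shows "(\<Sum>j=1..n. \<bar>x t j - x r j\<bar>) \<le> s * (t - r)"
proof -
  have "(\<Sum>j=1..n. \<bar>x t j - x r j\<bar>) \<le> (\<Sum>j=1..n. \<bar>x r j - x r j\<bar>) + s * (t - r)"
  proof (rule increment_le[OF assms(2)])
    show "continuous_on {r..t} (\<lambda>t. \<Sum>j=1..n. \<bar>x t j - x r j\<bar>)"
      using cont_coord assms(1) by (intro continuous_intros)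
    fix q assume q: "r \<le> q" "q < t"
    then obtain act where "performs (star kt kd a n) s x q act" using moves[of q] assms(1) by auto
    from performs_star[OF this speed_nonneg] obtain e i c where
      e: "e > 0" "\<bar>c\<bar> \<le> s"
      "\<And>h j. h \<in> {0..e} \<Longrightarrow> j \<ge> 1 \<Longrightarrow> x (q + h) j = x q j + (if j = i then c * h else 0)"
      by blast
    have "(\<Sum>j=1..n. \<bar>x (q + h) j - x r j\<bar>) \<le> (\<Sum>j=1..n. \<bar>x q j - x r j\<bar>) + s * h"
      if h: "h \<in> {0..e}" for h
    proof -
      have "(\<Sum>j=1..n. \<bar>x (q + h) j - x r j\<bar>)
          \<le> (\<Sum>j=1..n. \<bar>x q j - x r j\<bar> + (if j = i then \<bar>c * h\<bar> else 0))"
        using e(3)[OF h] by (intro sum_mono) auto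
      also have "\<dots> = (\<Sum>j=1..n. \<bar>x q j - x r j\<bar>) + (\<Sum>j=1..n. if j = i then \<bar>c * h\<bar> else 0)"
        by (rule sum.distrib)
      \<comment> \<open>Possibly strict, because \<open>i\<close> may lie outside
        \<open>{1..n}\<close>.\<close>
      also have "(\<Sum>j=1..n. if j = i then \<bar>c * h\<bar> else 0) \<le> \<bar>c * h\<bar>" by simp
      also have "\<bar>c * h\<bar> \<le> s * h"
        using e(2) h by (simp add: abs_mult mult_right_mono)
      finally show ?thesis by simp
    qed
    with e(1) show "\<exists>\<epsilon>>0. \<forall>h\<in>{0..\<epsilon>}. (\<Sum>j=1..n. \<bar>x (q + h) j - x r j\<bar>)
        \<le> (\<Sum>j=1..n. \<bar>x q j - x r j\<bar>) + s * h" by blast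
  qed
  then show ?thesis by simp
qed

lemma coord_lipschitz:
  assumes "0 \<le> r" "r \<le> t" "j \<in> {1..n}"
  shows "\<bar>x t j - x r j\<bar> \<le> s * (t - r)"
  using member_le_sum[OF assms(3), of "\<lambda>j. \<bar>x t j - x r j\<bar>"] l1_lipschitz[OF assms(1,2)]
  by simp

text \<open>The product of two leaf coordinates is 0 at the start and cannot grow: while one
  coordinate moves, all others are 0. Thus \<open>increment_le\<close> applies with
  \<open>c = 0\<close>.\<close>

lemma on_one_edge:
  assumes "t \<ge> 0" "i \<ge> 1" "j \<ge> 1" "i \<noteq> j"
  shows "x t i = 0 \<or> x t j = 0"
proof -
  have "\<bar>x t i * x t j\<bar> \<le> \<bar>x 0 i * x 0 j\<bar> + 0 * (t - 0)"
  proof (rule increment_le[OF assms(1)])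
    show "continuous_on {0..t} (\<lambda>t. \<bar>x t i * x t j\<bar>)"
      using cont_coord by (intro continuous_intros) auto
    fix q assume q: "0 \<le> q" "q < t"
    then obtain act where "performs (star kt kd a n) s x q act" using moves[of q] by auto
    from performs_star[OF this speed_nonneg] obtain e k c where
      e: "e > 0" "c = 0 \<or> (\<forall>j\<ge>1. j \<noteq> k \<longrightarrow> x q j = 0)"
      "\<And>h j. h \<in> {0..e} \<Longrightarrow> j \<ge> 1 \<Longrightarrow> x (q + h) j = x q j + (if j = k then c * h else 0)"
      by blast
    have "\<bar>x (q + h) i * x (q + h) j\<bar> \<le> \<bar>x q i * x q j\<bar> + 0 * h" if h: "h \<in> {0..e}" for h
      using e(2) e(3)[OF h assms(2)] e(3)[OF h assms(3)] assms by (cases "i = k") auto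
    with e(1) show "\<exists>\<epsilon>>0. \<forall>h\<in>{0..\<epsilon>}. \<bar>x (q + h) i * x (q + h) j\<bar> \<le> \<bar>x q i * x q j\<bar> + 0 * h"
      by blast
  qed
  then show ?thesis using assms start by (auto simp: node_pos_def)
qed

lemma leaf_visit_ge:
  assumes "t \<ge> 0" "v \<in> {1..n}" "x t = node_pos v"
  shows "1 \<le> s * t"
  using coord_lipschitz[of 0 t v] assms start by (auto simp: node_pos_def)

text \<open>Two leaf coordinates change by 1 each and the sum bound adds them up; a bound on single
  coordinates would give only 1.\<close>

lemma leaf_to_leaf_ge:
  assumes "0 \<le> r" "r \<le> t" "v \<in> {1..n}" "w \<in> {1..n}" "v \<noteq> w" "x r = node_pos v" "x t = node_pos w"
  shows "2 \<le> s * (t - r)"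
proof -
  have "(\<Sum>j\<in>{v, w}. \<bar>x t j - x r j\<bar>) \<le> (\<Sum>j=1..n. \<bar>x t j - x r j\<bar>)"
    using assms by (intro sum_mono2) auto
  then show ?thesis using l1_lipschitz[OF assms(1,2)] assms(5-7) by (simp add: node_pos_def)
qed

text \<open>The first leaf takes distance 1 and each further leaf distance 2, via the depot.\<close>

lemma last_visit_ge:
  assumes "finite V" "V \<noteq> {}" "V \<subseteq> {1..n}" "\<And>v. v \<in> V \<Longrightarrow> \<tau> v \<ge> 0 \<and> x (\<tau> v) = node_pos v"
  shows "\<exists>v\<in>V. 2 * real (card V) - 1 \<le> s * \<tau> v"
  using assms
\<comment> \<open>Leaves enter in order of their chosen visit times \<open>\<tau>\<close>, so the
  inserted \<open>w\<close> comes no earlier than those in \<open>V\<close>.\<close>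
proof (induction V rule: finite_ranking_induct[where f = \<tau>])
  case empty
  then show ?case by simp
next
  case (insert w V)
  show ?case
  \<comment> \<open>The inserted \<open>w\<close> may already be in \<open>V\<close>, and then
    nothing changes; for empty \<open>V\<close> the distance is 1 instead of 2.\<close>
  proof (cases "V = {} \<or> w \<in> V")
    case True
    then consider "V = {}" | "w \<in> V" by blast
    then show ?thesis
    proof cases
      case 1
      then show ?thesis using leaf_visit_ge[of "\<tau> w" w] insert.prems by simp
    next
      case 2
      then have "insert w V = V" by blast
      then show ?thesis using insert.IH insert.prems by simp
    qed
  next
    case False
    then obtain v where v: "v \<in> V" "2 * real (card V) - 1 \<le> s * \<tau> v"
      using insert by auto
    then have "2 \<le> s * (\<tau> w - \<tau> v)"
      using False insert.hyps insert.prems by (intro leaf_to_leaf_ge[of _ _ v w]) auto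
    then have "2 * real (card (insert w V)) - 1 \<le> s * \<tau> w"
      using v(2) False insert.hyps by (simp add: algebra_simps)
    then show ?thesis by blast
  qed
qed

text \<open>With \<open>m\<close> leaves visited, \<open>last_visit_ge\<close> puts one of the
  visits at time at least \<open>(2 * m - 1) / s\<close>, hence not before \<open>T\<close>. The
  interval excludes \<open>T\<close> since equality may occur: drones are treated with
  \<open>m = \<alpha>\<close> and \<open>s * T = 2 * \<alpha> - 1\<close>.\<close>

lemma card_visited:
  fixes m :: nat
  assumes "s > 0" "m \<ge> 1" "s * T \<le> 2 * real m - 1"
  shows "card {v \<in> {1..n}. \<exists>t\<in>{0..<T}. x t = node_pos v} \<le> m - 1"
proof (rule ccontr)
  let ?V = "{v \<in> {1..n}. \<exists>t\<in>{0..<T}. x t = node_pos v}"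
  assume "\<not> ?thesis"
  then have m: "card ?V \<ge> m" by simp
  then have ne: "?V \<noteq> {}" using assms(2) by (metis card.empty not_one_le_zero order.trans)
  have "\<forall>v\<in>?V. \<exists>t. t \<in> {0..<T} \<and> x t = node_pos v" by auto
  from bchoice[OF this] obtain \<tau> where \<tau>: "\<And>v. v \<in> ?V \<Longrightarrow> \<tau> v \<in> {0..<T} \<and> x (\<tau> v) = node_pos v"
    by blast
  have "\<exists>v\<in>?V. 2 * real (card ?V) - 1 \<le> s * \<tau> v"
  proof (rule last_visit_ge[OF _ ne])
    show "\<tau> v \<ge> 0 \<and> x (\<tau> v) = node_pos v" if "v \<in> ?V" for v using \<tau>[OF that] by simp
  qed auto
  then obtain v where v: "v \<in> ?V" "2 * real (card ?V) - 1 \<le> s * \<tau> v" ..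
  have "s * \<tau> v < s * T" using \<tau>[OF v(1)] assms(1) by simp
  then show False using v(2) assms(3) m by linarith
qed

end

section \<open>Executions and their dependence on the damage\<close>

lemma execution_star_motion:
  assumes "execution A (star kt kd a n) D X" "f \<in> vehicles (star kt kd a n)" "a \<ge> 0"
  shows "star_motion kt kd n a (speed (star kt kd a n) f) (X f)"
proof
  show "speed (star kt kd a n) f \<ge> 0" using assms(3) by (cases f) simp_all
  show "X f 0 = node_pos 0" "continuous_on {0..} (X f)"
    using assms(1,2) by (simp_all add: execution_def)
  show "\<exists>act. performs (star kt kd a n) (speed (star kt kd a n) f) (X f) t act" if "t \<ge> 0" for t
    using assms(1,2) that unfolding execution_def by blast
qed

text \<open>The policy learns of damage only through visits, so as long as the visited nodes have
  equal status in \<open>D\<close> and \<open>D'\<close> it sees the same data and acts the same.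
  Agreement includes time \<open>T\<close>, by continuity, although visits are restricted only
  before \<open>T\<close>.\<close>

lemma execution_agree:
  assumes ok: "rdp_data_ok K" and X: "execution A K D X" and Y: "execution A K D' Y"
    and unseen: "\<And>f r v. f \<in> vehicles K \<Longrightarrow> r \<in> {0..<T} \<Longrightarrow> X f r = node_pos v \<Longrightarrow> v \<in> D \<longleftrightarrow> v \<in> D'"
    and "t \<in> {0..T}" and "f \<in> vehicles K"
  shows "X f t = Y f t"
proof -
  have "\<forall>f\<in>vehicles K. X f t = Y f t"
    using assms(5)
  proof (induction rule: real_induction)
    case base
    show ?case using X Y by (simp add: execution_def)
  next
    case (step t)
    have rev: "revealed K D X t = revealed K D' Y t"
      unfolding revealed_def
      using step unseen by (intro ext if_cong conj_cong bex_cong arg_cong[where f = Some] refl) (fastforce+)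
    have "\<exists>\<epsilon>>0. \<forall>h\<in>{0..\<epsilon>}. X g (t + h) = Y g (t + h)" if g: "g \<in> vehicles K" for g
      using X Y g step rev unfolding execution_def
      by (intro performs_unique[OF ok]) auto
    then obtain e where e: "\<And>g. g \<in> vehicles K \<Longrightarrow> e g > 0"
      "\<And>g h. g \<in> vehicles K \<Longrightarrow> h \<in> {0..e g} \<Longrightarrow> X g (t + h) = Y g (t + h)" by metis
    define m where "m = Min (insert 1 (e ` vehicles K))"
    have "m > 0" using e(1) by (simp add: m_def)
    moreover have "m \<le> e g" if "g \<in> vehicles K" for g using that by (simp add: m_def)
    ultimately show ?case using e(2) by (intro exI[of _ m]) fastforce
  next
    case (limit t)
    show ?case
    proof (intro ballI ext)
      fix g v assume g: "g \<in> vehicles K"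
      have "continuous_on {0..} (X g)" "continuous_on {0..} (Y g)"
        using X Y g by (auto simp: execution_def)
      then have c: "continuous_on {0..t} (\<lambda>r. X g r v - Y g r v)"
        by (intro continuous_intros) (auto dest!: continuous_on_product_then_coordinatewise
            intro: continuous_on_subset)
      have "closed {r \<in> {0..t}. X g r v - Y g r v = 0}"
        using c closed_atLeastAtMost by (rule continuous_closed_preimage_constant)
      moreover have "{0..<t} \<subseteq> {r \<in> {0..t}. X g r v - Y g r v = 0}"
        using limit g by auto
      ultimately have "closure {0..<t} \<subseteq> {r \<in> {0..t}. X g r v - Y g r v = 0}"
        by (rule closure_minimal[rotated])
      then show "X g t v = Y g t v" using limit by (simp add: subset_iff)
    qed
  qed
  with assms(6) show ?thesis by blast
qed

text \<open>\<open>policy_time\<close> picks some execution, while \<open>online_policy\<close>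
  promises just one that is feasible. By \<open>execution_unique\<close> the two coincide for all
  vehicles from time 0 on.\<close>

lemma policy_execution:
  assumes "online_policy A" "rdp_instance K D"
  obtains X where "execution A K D X" "executed_feasible K D X"
    "policy_time A K D = completion_time K X"
proof
  let ?X = "SOME X. execution A K D X"
  obtain Y where Y: "execution A K D Y" "executed_feasible K D Y"
    using assms by (auto simp: online_policy_def)
  show X: "execution A K D ?X" using Y(1) by (rule someI[of "execution A K D"])
  have ok: "rdp_data_ok K" using assms(2) by (simp add: rdp_instance_def)
  have eq: "?X f t = Y f t" if "f \<in> vehicles K" "t \<ge> 0" for f t
    using execution_unique[OF ok X Y(1) that] .
  have tr: "Truck i \<in> vehicles K" if "i < n_trucks K" for i using that by (simp add: vehicles_def)
  show "executed_feasible K D ?X"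
    unfolding executed_feasible_def home_from_def
  proof (intro conjI ballI)
    from Y(2) obtain T where "T \<ge> 0" "\<forall>f\<in>vehicles K. \<forall>t\<ge>T. Y f t = node_pos (depot K)"
      by (auto simp: executed_feasible_def home_from_def)
    then show "\<exists>T\<ge>0. \<forall>f\<in>vehicles K. \<forall>t\<ge>T. ?X f t = node_pos (depot K)"
      using eq by (intro exI[of _ T]) auto
  next
    fix v assume "v \<in> customers K"
    with Y(2) obtain f t where "f \<in> vehicles K" "t \<ge> 0" "Y f t = node_pos v"
      by (auto simp: executed_feasible_def)
    then show "\<exists>f\<in>vehicles K. \<exists>t\<ge>0. ?X f t = node_pos v" using eq by metis
  next
    fix v assume "v \<in> D"
    with Y(2) obtain i t where "i < n_trucks K" "t \<ge> 0" "Y (Truck i) t = node_pos v"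
      by (auto simp: executed_feasible_def)
    then show "\<exists>i<n_trucks K. \<exists>t\<ge>0. ?X (Truck i) t = node_pos v" using eq tr by metis
  qed
  show "policy_time A K D = completion_time K ?X" by (simp add: policy_time_def)
qed

section \<open>The choice of the damaged leaf and the lower bound\<close>

text \<open>Trucks exclude at most \<open>kt\<close> leaves and drones at most
  \<open>kd * (\<alpha> - 1)\<close>, together \<open>kd\<close> fewer than there are.\<close>

lemma untouched_leaf:
  fixes kt kd \<alpha> :: nat and D :: "nat set"
  defines "K \<equiv> star kt kd (real \<alpha>) (kt + \<alpha> * kd)" and "T \<equiv> 2 - 1 / real \<alpha>"
  assumes "kd \<ge> 1" "\<alpha> \<ge> 1" and X: "execution A K D X"
  obtains L where "L \<in> {1..kt + \<alpha> * kd}"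
    and "\<And>f t. f \<in> vehicles K \<Longrightarrow> t \<in> {0..<T} \<Longrightarrow> X f t \<noteq> node_pos L"
    and "\<And>i. i < kt \<Longrightarrow> X (Truck i) T L = 0"
proof -
  let ?n = "kt + \<alpha> * kd"
  let ?Vd = "\<lambda>j. {v \<in> {1..?n}. \<exists>t\<in>{0..<T}. X (Drone j) t = node_pos v}"
  let ?Vt = "\<lambda>i. {v \<in> {1..?n}. X (Truck i) T v \<noteq> 0}"
  \<comment> \<open>\<open>T < 2\<close> is too early for a truck to be back from a leaf;
    \<open>\<alpha> * T\<close> is the distance a drone needs for its \<open>\<alpha>\<close>-th
    leaf.\<close>
  have T: "1 \<le> T" "T < 2" "real \<alpha> * T = 2 * real \<alpha> - 1"
    using \<open>\<alpha> \<ge> 1\<close> by (auto simp: T_def field_simps)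
  have truck: "star_motion kt kd ?n (real \<alpha>) 1 (X (Truck i))" if "i < kt" for i
    using execution_star_motion[OF X[unfolded K_def], of "Truck i"] that by (simp add: vehicles_def)
  have drone: "star_motion kt kd ?n (real \<alpha>) (real \<alpha>) (X (Drone j))" if "j < kd" for j
    using execution_star_motion[OF X[unfolded K_def], of "Drone j"] that by (simp add: vehicles_def)
  have Vd: "card (?Vd j) \<le> \<alpha> - 1" if "j < kd" for j
    using star_motion.card_visited[OF drone[OF that], of \<alpha> T] T \<open>\<alpha> \<ge> 1\<close> by simp
  have Vt: "card (?Vt i) \<le> 1" if "i < kt" for i
    using star_motion.on_one_edge[OF truck[OF that], of T] T
    by (auto simp: card_le_Suc0_iff_eq)
  have "card ((\<Union>i<kt. ?Vt i) \<union> (\<Union>j<kd. ?Vd j)) \<le> card (\<Union>i<kt. ?Vt i) + card (\<Union>j<kd. ?Vd j)"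
    by (rule card_Un_le)
  also have "\<dots> \<le> (\<Sum>i<kt. card (?Vt i)) + (\<Sum>j<kd. card (?Vd j))"
    by (intro add_mono card_UN_le) auto
  also have "\<dots> \<le> (\<Sum>i<kt. 1) + (\<Sum>j<kd. \<alpha> - 1)"
    using Vd Vt by (intro add_mono sum_mono) auto
  also have "\<dots> < card {1..?n}"
    using \<open>kd \<ge> 1\<close> \<open>\<alpha> \<ge> 1\<close> by (simp add: mult.commute)
  finally have "\<not> {1..?n} \<subseteq> (\<Union>i<kt. ?Vt i) \<union> (\<Union>j<kd. ?Vd j)"
    using card_mono[of "(\<Union>i<kt. ?Vt i) \<union> (\<Union>j<kd. ?Vd j)" "{1..?n}"] by fastforce
  then obtain L where L1: "L \<in> {1..?n}" and L': "L \<notin> (\<Union>i<kt. ?Vt i) \<union> (\<Union>j<kd. ?Vd j)"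
    by (meson subsetI)
  have L2: "X (Truck i) T L = 0" if "i < kt" for i using L1 L' that by simp
  have L3: "X (Drone j) t \<noteq> node_pos L" if "j < kd" "t \<in> {0..<T}" for j t using L1 L' that by auto
  note L = L1 L2 L3
  \<comment> \<open>Trucks were counted only by their position at \<open>T\<close>. An earlier visit
    to \<open>L\<close>, at time at least 1, would leave less than 1 to bring the coordinate back to
    0.\<close>
  have "X (Truck i) t \<noteq> node_pos L" if "i < kt" "t \<in> {0..<T}" for i t
  proof
    assume eq: "X (Truck i) t = node_pos L"
    then have "1 \<le> t" using star_motion.leaf_visit_ge[OF truck[OF that(1)], of t L] that L(1) by simp
    moreover have "1 \<le> T - t"
      using star_motion.coord_lipschitz[OF truck[OF that(1)], of t T L] that L(1) L(2)[OF that(1)] eq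
      by (simp add: node_pos_def)
    ultimately show False using T by simp
  qed
  then have unseen: "X f t \<noteq> node_pos L" if "f \<in> vehicles K" "t \<in> {0..<T}" for f t
    using L(3) that by (auto simp: K_def vehicles_def)
  show ?thesis by (rule that[OF L(1) unseen L(2)])
qed

theorem lemma25:
  fixes kt kd \<alpha> :: nat and ALG :: "nat policy"
  assumes "kt \<ge> 1" and "kd \<ge> 1" and "\<alpha> \<ge> 1"
    and "online_policy ALG"
  shows "\<exists>K D. rdp_instance K D \<and>
           n_trucks K = kt \<and> n_drones K = kd \<and> drone_speed K = real \<alpha> \<and>
           policy_time ALG K D / OPT K D \<ge> 2 - 1 / (2 * real \<alpha>)"
proof -
  let ?n = "kt + \<alpha> * kd"
  define K where "K = star kt kd (real \<alpha>) ?n"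
  define T where "T = 2 - 1 / real \<alpha>"
  have ok: "rdp_data_ok K"
    unfolding K_def using assms by (intro star_ok) auto
  have inst: "rdp_instance K D" if "D \<subseteq> {1..?n}" for D
    using ok that by (simp add: rdp_instance_def K_def)
  \<comment> \<open>The run without damage selects \<open>L\<close>; it is then compared with the
    run on \<open>{L}\<close>.\<close>
  obtain X where X: "execution ALG K {} X"
    using assms(4) inst[of "{}"] by (auto simp: online_policy_def)
  obtain L where L: "L \<in> {1..?n}"
    "\<And>f t. f \<in> vehicles K \<Longrightarrow> t \<in> {0..<T} \<Longrightarrow> X f t \<noteq> node_pos L"
    "\<And>i. i < kt \<Longrightarrow> X (Truck i) T L = 0"
    using untouched_leaf[OF assms(2,3) X[unfolded K_def]] unfolding K_def T_def by metis
  have instL: "rdp_instance K {L}" using inst L(1) by simp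
  obtain Y where Y: "execution ALG K {L} Y" "executed_feasible K {L} Y"
    "policy_time ALG K {L} = completion_time K Y"
    using policy_execution[OF assms(4) instL] by blast
  have "T \<ge> 0" using assms(3) by (simp add: T_def field_simps)
  have agree: "X f t = Y f t" if "f \<in> vehicles K" "t \<in> {0..T}" for f t
    using that L(2) by (intro execution_agree[OF ok X Y(1), of T]) auto
  obtain i t where i: "i < kt" "t \<ge> 0" "Y (Truck i) t = node_pos L"
    using Y(2) by (auto simp: executed_feasible_def K_def)
  have f: "Truck i \<in> vehicles K" using i(1) by (simp add: vehicles_def K_def)
  have motion: "star_motion kt kd ?n (real \<alpha>) 1 (Y (Truck i))"
    using execution_star_motion[OF Y(1)[unfolded K_def], of "Truck i"] f by (simp add: K_def)
  have "T \<le> t"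
  proof (rule ccontr)
    assume "\<not> T \<le> t"
    then show False using agree[OF f, of t] L(2)[OF f, of t] i by simp
  qed
  \<comment> \<open>Agreement at \<open>T\<close> itself matters here: the truck that will serve
    \<open>L\<close> is not yet on its edge, so it needs one more unit of time.\<close>
  have "Y (Truck i) T L = 0" using agree[OF f, of T] L(3)[OF i(1)] \<open>T \<ge> 0\<close> by simp
  then have t: "T + 1 \<le> t"
    using star_motion.coord_lipschitz[OF motion \<open>T \<ge> 0\<close> \<open>T \<le> t\<close> L(1)] i(3)
    by (simp add: node_pos_def)
  have home: "T + 2 \<le> H" if "home_from K Y H" for H
  proof -
    have Y0: "Y (Truck i) r L = 0" if "r \<ge> H" for r
      using \<open>home_from K Y H\<close> f that L(1) by (simp add: home_from_def K_def node_pos_def)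
    have "t \<le> H" using Y0[of t] i(3) by (cases "t \<le> H") (auto simp: node_pos_def)
    then show ?thesis
      using star_motion.coord_lipschitz[OF motion i(2) _ L(1), of H] Y0[of H] i(3) t
      by (simp add: node_pos_def)
  qed
  have "completion_time K Y \<ge> T + 2"
    unfolding completion_time_def
    using Y(2) home by (intro cInf_greatest) (auto simp: executed_feasible_def)
  then have ALG: "policy_time ALG K {L} \<ge> 4 - 1 / real \<alpha>" using Y(3) by (simp add: T_def)
  have OPT: "OPT K {L} > 0" "OPT K {L} \<le> 2"
    unfolding K_def using star_OPT assms L(1) by auto
  \<comment> \<open>\<open>4 - 1 / \<alpha>\<close> is twice \<open>2 - 1 / (2 * \<alpha>)\<close>,
    and \<open>OPT\<close> is at most 2.\<close>
  have "(2 - 1 / (2 * real \<alpha>)) * OPT K {L} \<le> (2 - 1 / (2 * real \<alpha>)) * 2"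
    using OPT(2) assms(3) by (intro mult_left_mono) (auto simp: field_simps)
  also have "\<dots> \<le> policy_time ALG K {L}" using ALG by (simp add: field_simps)
  finally have "2 - 1 / (2 * real \<alpha>) \<le> policy_time ALG K {L} / OPT K {L}"
    using OPT(1) by (simp add: pos_le_divide_eq)
  then show ?thesis using instL by (intro exI[of _ K] exI[of _ "{L}"]) (simp add: K_def)
qed

end
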